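(* Let $d\ge 2$ be an integer, let $A,B,C,D$ be quantum systems each with Hilbert space $\mathbb{C}^d$, and let $|\phi\rangle_{AB}$ and $|\psi\rangle_{CD}$ be pure states (unit vectors) in $\mathbb{C}^d\otimes\mathbb{C}^d$ with Schmidt decompositions $$|\phi\rangle_{AB}=\sum_{j=0}^{d-1}\sqrt{p_j}\,|a_j\rangle_A|b_j\rangle_B,\qquad |\psi\rangle_{CD}=\sum_{j=0}^{d-1}\sqrt{q_j}\,|c_j\rangle_C|d_j\rangle_D,$$ where $(a_j),(b_j),(c_j),(d_j)$ are orthonormal bases of $\mathbb{C}^d$, $p_j,q_j\ge 0$ and $\sum_j p_j=\sum_j q_j=1$. Put $|\Phi\rangle_{ABCD}=|\phi\rangle_{AB}\otimes|\psi\rangle_{CD}$ and $\rho_{AC}=\mathrm{tr}_{BD}\,|\Phi\rangle_{ABCD}\langle\Phi|$. Then $$\mathcal{N}^a(\rho_{AC})\ \geq\ \frac{2}{d-1}\sum_{k=0}^{d-1}\ \sum_{0\le j<j'\le d-1}\sqrt{p_j p_{j'}}\,\sqrt{q_{j+k}\,q_{j'+k}},$$ where the indices $j+k$ and $j'+k$ are taken modulo $d$.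
   Context: For a state (density matrix) $\rho_{XY}$ on $\mathbb{C}^d\otimes\mathbb{C}^d$ ($d\ge 2$), the negativity is $\mathcal{N}(\rho_{XY})=\dfrac{\|\rho_{XY}^{T_Y}\|_1-1}{d-1}$, where $\|\cdot\|_1$ is the trace norm and $T_Y$ denotes partial transposition on the second factor. For a pure state with Schmidt decomposition $\sum_{i=0}^{d-1}\sqrt{\lambda_i}\,|e_i\rangle|f_i\rangle$ ($\lambda_i\ge 0$, $\sum_i\lambda_i=1$, orthonormal bases $(e_i)$, $(f_i)$), this equals $\frac{2}{d-1}\sum_{i<j}\sqrt{\lambda_i\lambda_j}$. The negativity of assistance (NoA) is $\mathcal{N}^a(\rho_{XY})=\max\sum_k p_k\,\mathcal{N}(|\psi_k\rangle_{XY})$, where the maximum is over all pure-state decompositions $\rho_{XY}=\sum_k p_k|\psi_k\rangle\langle\psi_k|$ (finite ensembles with $p_k\ge 0$, $\sum_k p_k=1$, $|\psi_k\rangle$ unit vectors). The state $\rho_{AC}$ is regarded as a bipartite state with respect to the splitting $A|C$. *)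

theory Defs
  imports "HOL-Analysis.Analysis"
begin

text \<open>
  The space \<open>\<complex>\<^sup>d\<close> is \<^typ>\<open>complex ^ 'd\<close> with \<open>d = CARD('d)\<close>, and \<open>\<complex>\<^sup>d \<otimes> \<complex>\<^sup>d\<close> is
  \<^typ>\<open>complex ^ ('d \<times> 'd)\<close>, using the product basis.  The inner product class of HOL-Analysis
  is real-valued, so the Hermitian product is introduced separately; \<^const>\<open>norm\<close> is its norm.
\<close>

definition cinner :: "complex ^ 'n::finite \<Rightarrow> complex ^ 'n \<Rightarrow> complex" where
  "cinner u v = (\<Sum>i\<in>UNIV. cnj (u $ i) * v $ i)"

definition orthonormal_family :: "nat \<Rightarrow> (nat \<Rightarrow> complex ^ 'n::finite) \<Rightarrow> bool" where
  "orthonormal_family m e \<longleftrightarrow>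
     (\<forall>i<m. \<forall>j<m. cinner (e i) (e j) = (if i = j then 1 else 0))"

text \<open>An orthonormal family of \<open>dim\<close> many vectors is a basis.\<close>

definition orthonormal_basis :: "(nat \<Rightarrow> complex ^ 'n::finite) \<Rightarrow> bool" where
  "orthonormal_basis e \<longleftrightarrow> orthonormal_family CARD('n) e"

definition tensor_vec ::
    "complex ^ 'm::finite \<Rightarrow> complex ^ 'n::finite \<Rightarrow> complex ^ ('m \<times> 'n)" where
  "tensor_vec u v = (\<chi> i. u $ fst i * v $ snd i)"

definition adjoint_mat :: "complex ^ 'n::finite ^ 'm::finite \<Rightarrow> complex ^ 'm ^ 'n" where
  "adjoint_mat M = (\<chi> i j. cnj (M $ j $ i))"

definition pure_state :: "complex ^ 'n::finite \<Rightarrow> complex ^ 'n ^ 'n" where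
  "pure_state \<psi> = (\<chi> i j. \<psi> $ i * cnj (\<psi> $ j))"

definition positive_semidefinite :: "complex ^ 'n::finite ^ 'n \<Rightarrow> bool" where
  "positive_semidefinite M \<longleftrightarrow>
     adjoint_mat M = M \<and> (\<forall>v. 0 \<le> Re (cinner v (M *v v)))"

definition sqrt_mat :: "complex ^ 'n::finite ^ 'n \<Rightarrow> complex ^ 'n ^ 'n" where
  "sqrt_mat M = (THE P. positive_semidefinite P \<and> P ** P = M)"

definition trace_norm :: "complex ^ 'n::finite ^ 'n \<Rightarrow> real" where
  "trace_norm M = Re (trace (sqrt_mat (adjoint_mat M ** M)))"

definition partial_transpose ::
    "complex ^ ('m::finite \<times> 'n::finite) ^ ('m \<times> 'n) \<Rightarrow> complex ^ ('m \<times> 'n) ^ ('m \<times> 'n)" where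
  "partial_transpose M = (\<chi> r s. M $ (fst r, snd s) $ (fst s, snd r))"

definition negativity :: "complex ^ ('d::finite \<times> 'd) ^ ('d \<times> 'd) \<Rightarrow> real" where
  "negativity \<rho> = (trace_norm (partial_transpose \<rho>) - 1) / (real CARD('d) - 1)"

definition pure_decomposition ::
    "complex ^ 'n::finite ^ 'n \<Rightarrow> nat \<Rightarrow> (nat \<Rightarrow> real) \<Rightarrow> (nat \<Rightarrow> complex ^ 'n) \<Rightarrow> bool" where
  "pure_decomposition \<rho> m w \<psi> \<longleftrightarrow>
     (\<forall>k<m. 0 \<le> w k \<and> norm (\<psi> k) = 1) \<and> (\<Sum>k<m. w k) = 1 \<and>
     \<rho> = (\<Sum>k<m. w k *\<^sub>R pure_state (\<psi> k))"

text \<open>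
  The maximum over pure-state decompositions is written as a supremum; the set of values is
  bounded for every \<open>\<rho>\<close> and nonempty when \<open>\<rho>\<close> is a density matrix.
\<close>

definition negativity_of_assistance ::
    "complex ^ ('d::finite \<times> 'd) ^ ('d \<times> 'd) \<Rightarrow> real" where
  "negativity_of_assistance \<rho> =
     Sup {\<Sum>k<m. w k * negativity (pure_state (\<psi> k)) | m w \<psi>. pure_decomposition \<rho> m w \<psi>}"

text \<open>
  Partial trace over the second and fourth factor of \<open>(A \<otimes> B) \<otimes> (C \<otimes> D)\<close>.
\<close>

definition trace_BD ::
    "complex ^ (('a::finite \<times> 'b::finite) \<times> ('c::finite \<times> 'd::finite))
             ^ (('a \<times> 'b) \<times> ('c \<times> 'd)) \<Rightarrow> complex ^ ('a \<times> 'c) ^ ('a \<times> 'c)" where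
  "trace_BD M = (\<chi> r s. \<Sum>b\<in>UNIV. \<Sum>d\<in>UNIV.
     M $ ((fst r, b), (snd r, d)) $ ((fst s, b), (snd s, d)))"

end

theory Submission imports Defs begin

text \<open>
  The reduced state is \<open>\<rho>\<^sub>A\<^sub>C = \<Sum>\<^sub>j\<^sub>l p\<^sub>j q\<^sub>l |a\<^sub>j c\<^sub>l\<rangle>\<langle>a\<^sub>j c\<^sub>l|\<close>.  Group its eigenvectors by the shift \<open>k = (l - j) mod d\<close>
  and, with \<open>\<omega>\<close> a primitive \<open>d\<close>-th root of unity, put
  \<open>\<eta>\<^sub>k\<^sub>m = \<Sum>\<^sub>j \<omega>\<^bsup>jm\<^esup> sqrt (p\<^sub>j q\<^bsub>j+k\<^esub>) |a\<^sub>j\<rangle>|c\<^bsub>j+k\<^esub>\<rangle>\<close>.  Averaging over \<open>m\<close> removes the coherences, so the vectors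
  \<open>\<eta>\<^sub>k\<^sub>m / sqrt d\<close> form an ensemble for \<open>\<rho>\<^sub>A\<^sub>C\<close>.  They are already in Schmidt form once the phases are
  absorbed in the second factor, and their average negativity is the asserted lower bound.
\<close>

section \<open>Hermitian matrices and uniqueness of positive semidefinite square roots\<close>

lemma Re_cinner: "Re (cinner u v) = u \<bullet> v"
  by (simp add: cinner_def inner_vec_def inner_complex_def)

lemma cinner_adjoint_mat: "cinner (adjoint_mat M *v u) v = cinner u (M *v v)"
  unfolding cinner_def adjoint_mat_def matrix_vector_mult_def
  by (simp add: sum_distrib_left sum_distrib_right, subst sum.swap) (simp add: ac_simps)

lemma inner_hermitian:
  assumes "adjoint_mat M = M"
  shows "(M *v u) \<bullet> v = u \<bullet> (M *v v)"
  using cinner_adjoint_mat[of M u v] by (metis assms Re_cinner)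

lemma mult_axis_nth: "(M *v axis i 1) $ j = M $ j $ i" for M :: "complex ^ 'n::finite ^ 'm::finite"
  by (simp add: matrix_vector_mult_def axis_def if_distrib cong: if_cong)

lemma Re_trace: "Re (trace M) = (\<Sum>i\<in>UNIV. axis i 1 \<bullet> (M *v axis i 1))"
  by (simp add: trace_def inner_axis' mult_axis_nth)

lemma matrix_vector_mult_scaleR_right:
  fixes M :: "complex ^ 'n::finite ^ 'm::finite"
  shows "M *v (t *\<^sub>R v) = t *\<^sub>R (M *v v)"
  by (simp add: vec_eq_iff matrix_vector_mult_def scaleR_sum_right)

lemma matrix_diff_ldistrib: "A ** (B - C) = A ** B - A ** C" for A :: "complex ^ 'n::finite ^ 'm::finite"
  by (simp add: matrix_matrix_mult_def vec_eq_iff right_diff_distrib sum_subtractf)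

lemma matrix_diff_rdistrib: "(A - B) ** C = A ** C - B ** C" for A :: "complex ^ 'n::finite ^ 'm::finite"
  by (simp add: matrix_matrix_mult_def vec_eq_iff left_diff_distrib sum_subtractf)

lemma matrix_mult_0_right: "A ** 0 = 0" for A :: "complex ^ 'n::finite ^ 'm::finite"
  by (simp add: matrix_matrix_mult_def vec_eq_iff)

lemma psd_inner_ge_0: "positive_semidefinite P \<Longrightarrow> 0 \<le> v \<bullet> (P *v v)"
  by (simp add: positive_semidefinite_def Re_cinner)

text \<open>A zero of a nonnegative quadratic form is a minimum. Moving \<open>v\<close> slightly
  against \<open>P *v v\<close> would lower the form to first order unless \<open>P *v v\<close>
  vanishes.\<close>

lemma psd_inner_eq_0_imp_mult_eq_0:
  assumes P: "positive_semidefinite P" and 0: "v \<bullet> (P *v v) = 0"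
  shows "P *v v = 0"
proof (rule ccontr)
  define w where "w = P *v v"
  define n where "n = w \<bullet> w"
  define k where "k = w \<bullet> (P *v w)"
  assume "P *v v \<noteq> 0"
  then have n: "n > 0" by (simp add: n_def w_def)
  have k: "k \<ge> 0" unfolding k_def by (rule psd_inner_ge_0[OF P])
  \<comment> \<open>The form at \<open>v + t w\<close> is \<open>t * (2 * n + t * k)\<close>, which
    is negative when \<open>t < 0\<close> and \<open>2 * n + t * k > 0\<close>. For
    \<open>k > 0\<close> the minimiser \<open>- n / k\<close> would do; the denominator
    \<open>k + 1\<close> covers \<open>k = 0\<close> as well.\<close>
  define t where "t = - n / (k + 1)"
  have vw: "v \<bullet> (P *v w) = n"
    using P inner_hermitian[of P v w]
    by (simp add: positive_semidefinite_def n_def w_def)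
  have "(v + t *\<^sub>R w) \<bullet> (P *v (v + t *\<^sub>R w)) = t * (2 * n + t * k)"
    using 0 vw by (simp add: matrix_vector_right_distrib matrix_vector_mult_scaleR_right
        inner_add_left inner_add_right w_def[symmetric] n_def[symmetric] k_def[symmetric]
        algebra_simps)
  then have ge: "0 \<le> t * (2 * n + t * k)"
    using psd_inner_ge_0[OF P] by metis
  have "t < 0" using n k by (simp add: t_def divide_neg_pos)
  moreover have "2 * n + t * k > 0"
  proof -
    have "n * k \<le> n * (k + 1)" using n by simp
    then have "n * k / (k + 1) \<le> n" using k by (simp add: divide_le_eq)
    then show ?thesis using n by (simp add: t_def)
  qed
  ultimately show False using ge by (simp add: zero_le_mult_iff)
qed

text \<open>
  With \<open>D = P - Q\<close> one has \<open>P D + D Q = P\<^sup>2 - Q\<^sup>2 = 0\<close>, so \<open>tr (D P D) + tr (D Q D) = 0\<close>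
  with both summands nonnegative.
\<close>

lemma psd_sqrt_unique:
  assumes P: "positive_semidefinite P" and Q: "positive_semidefinite Q"
    and eq: "P ** P = Q ** Q"
  shows "P = Q"
proof -
  define D where "D = P - Q"
  have hP: "adjoint_mat P = P" and hQ: "adjoint_mat Q = Q"
    using P Q by (auto simp: positive_semidefinite_def)
  have hD: "adjoint_mat D = D"
    using hP hQ by (simp add: D_def adjoint_mat_def vec_eq_iff)
  have tr: "Re (trace (D ** (X ** D))) = (\<Sum>i\<in>UNIV. (D *v axis i 1) \<bullet> (X *v (D *v axis i 1)))" for X
    unfolding Re_trace
    by (simp add: matrix_vector_mul_assoc[symmetric] inner_hermitian[OF hD])
  have "P ** D + D ** Q = 0"

    by (simp add: D_def matrix_diff_ldistrib matrix_diff_rdistrib eq)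
  then have "D ** (P ** D) + D ** (D ** Q) = 0"
    by (simp add: matrix_mult_0_right flip: matrix_add_ldistrib)
  then have "trace (D ** (P ** D)) + trace (D ** (D ** Q)) = 0"
    by (simp add: trace_add[symmetric]) (simp add: trace_def)
  \<comment> \<open>Cyclicity of the trace brings the second summand into the shape
    \<open>D X D\<close>, which \<open>tr\<close> expands into quadratic forms at the columns of
    \<open>D\<close>.\<close>
  moreover have "trace (D ** (D ** Q)) = trace (D ** (Q ** D))"
    using trace_mul_sym[of D "D ** Q"] by (simp add: matrix_mul_assoc)
  ultimately have sum0: "(\<Sum>i\<in>UNIV. (D *v axis i 1) \<bullet> (P *v (D *v axis i 1))) +
      (\<Sum>i\<in>UNIV. (D *v axis i 1) \<bullet> (Q *v (D *v axis i 1))) = 0"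
    by (simp add: complex_eq_iff flip: tr)
  have nn: "0 \<le> (\<Sum>i\<in>UNIV. (D *v axis i 1) \<bullet> (X *v (D *v axis i 1)))"
    if "positive_semidefinite X" for X
    by (intro sum_nonneg psd_inner_ge_0 that)
  have zero: "X *v (D *v axis i 1) = 0"
    if X: "positive_semidefinite X"
      and s0: "(\<Sum>i\<in>UNIV. (D *v axis i 1) \<bullet> (X *v (D *v axis i 1))) = 0" for X i
  proof (rule psd_inner_eq_0_imp_mult_eq_0[OF X])
    have "\<forall>i\<in>UNIV. (D *v axis i 1) \<bullet> (X *v (D *v axis i 1)) = 0"
      using s0 by (subst (asm) sum_nonneg_eq_0_iff) (auto intro: psd_inner_ge_0[OF X])
    then show "(D *v axis i 1) \<bullet> (X *v (D *v axis i 1)) = 0" by blast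
  qed
  \<comment> \<open>Both \<open>P\<close> and \<open>Q\<close> annihilate every column of
    \<open>D\<close>, hence so does \<open>D\<close>. As \<open>D\<close> is Hermitian, the squared
    length of column \<open>i\<close> is the form of \<open>D ** D\<close> at
    \<open>axis i 1\<close>, which is zero.\<close>
  have "D *v axis i 1 = 0" for i
  proof -
    have "P *v (D *v axis i 1) = 0"
      by (rule zero[OF P]) (use sum0 nn[OF P] nn[OF Q] in linarith)
    moreover have "Q *v (D *v axis i 1) = 0"
      by (rule zero[OF Q]) (use sum0 nn[OF P] nn[OF Q] in linarith)
    ultimately have "D *v (D *v axis i 1) = 0"
      by (simp add: D_def matrix_vector_mult_diff_rdistrib)
    then have "(D *v axis i 1) \<bullet> (D *v axis i 1) = 0"
      by (simp add: inner_hermitian[OF hD])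
    then show ?thesis by simp
  qed
  then have "D = 0"
    unfolding vec_eq_iff by (simp flip: mult_axis_nth)
  then show ?thesis by (simp add: D_def)
qed

text \<open>Resolves the definite description in \<open>sqrt_mat\<close>: by uniqueness, exhibiting
  one positive semidefinite root determines the value.\<close>

lemma sqrt_mat_eqI:
  assumes "positive_semidefinite P" and "P ** P = M"
  shows "sqrt_mat M = P"
  unfolding sqrt_mat_def using assms psd_sqrt_unique by blast

section \<open>Sums of rank-one operators \<open>|u><v|\<close> and their trace norm\<close>

definition outer :: "complex ^ 'm::finite \<Rightarrow> complex ^ 'n::finite \<Rightarrow> complex ^ 'n ^ 'm" where
  "outer u v = (\<chi> i j. u $ i * cnj (v $ j))"

lemma adjoint_sum_outer:
  "adjoint_mat (\<Sum>i\<in>I. s i *\<^sub>R outer (u i) (v i)) = (\<Sum>i\<in>I. s i *\<^sub>R outer (v i) (u i))"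
  by (simp add: adjoint_mat_def outer_def vec_eq_iff mult.commute)

text \<open>Since \<open>|u><v| |w><z| = <v,w> |u><z|\<close>, biorthonormality of the two inner
  families leaves only the diagonal terms.\<close>

lemma sum_outer_mult_sum_outer:
  assumes "finite I" and "\<And>i j. i \<in> I \<Longrightarrow> j \<in> I \<Longrightarrow> cinner (v i) (w j) = (if i = j then 1 else 0)"
  shows "(\<Sum>i\<in>I. s i *\<^sub>R outer (u i) (v i)) ** (\<Sum>j\<in>I. t j *\<^sub>R outer (w j) (z j)) =
    (\<Sum>i\<in>I. (s i * t i) *\<^sub>R outer (u i) (z i))"
proof -
  have "((\<Sum>i\<in>I. s i *\<^sub>R outer (u i) (v i)) ** (\<Sum>j\<in>I. t j *\<^sub>R outer (w j) (z j))) $ x $ y =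
    (\<Sum>i\<in>I. (s i * t i) *\<^sub>R outer (u i) (z i)) $ x $ y" for x y
  proof -
    have "((\<Sum>i\<in>I. s i *\<^sub>R outer (u i) (v i)) ** (\<Sum>j\<in>I. t j *\<^sub>R outer (w j) (z j))) $ x $ y =
      (\<Sum>k\<in>UNIV. \<Sum>i\<in>I. \<Sum>j\<in>I. s i * t j * (u i $ x * cnj (z j $ y)) * (cnj (v i $ k) * w j $ k))"
      by (simp add: matrix_matrix_mult_def outer_def sum_product scaleR_conv_of_real[where 'a=complex] ac_simps)
    also have "\<dots> = (\<Sum>i\<in>I. \<Sum>j\<in>I. s i * t j * (u i $ x * cnj (z j $ y)) * cinner (v i) (w j))"
      unfolding cinner_def sum_distrib_left
      by (subst sum.swap, rule sum.cong[OF refl], rule sum.swap)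
    also have "\<dots> = (\<Sum>i\<in>I. \<Sum>j\<in>I. if j = i then s i * t j * (u i $ x * cnj (z j $ y)) else 0)"
      using assms(2) by (intro sum.cong refl) auto
    also have "\<dots> = (\<Sum>i\<in>I. s i * t i * (u i $ x * cnj (z i $ y)))"
      using assms(1) by simp
    finally show ?thesis by (simp add: outer_def scaleR_conv_of_real[where 'a=complex])
  qed
  then show ?thesis by (simp add: vec_eq_iff)
qed

text \<open>The quadratic form at \<open>x\<close> is the sum of the nonnegative terms
  \<open>s i * |<v i, x>|^2\<close>.\<close>

lemma psd_sum_outer:
  assumes "\<And>i. i \<in> I \<Longrightarrow> 0 \<le> s i"
  shows "positive_semidefinite (\<Sum>i\<in>I. s i *\<^sub>R outer (v i) (v i))"
proof -
  have "cinner x ((\<Sum>i\<in>I. s i *\<^sub>R outer (v i) (v i)) *v x) =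
      (\<Sum>i\<in>I. of_real (s i * (cmod (cinner (v i) x))\<^sup>2))" for x
  proof -
    have "cinner x ((\<Sum>i\<in>I. s i *\<^sub>R outer (v i) (v i)) *v x) =
      (\<Sum>k\<in>UNIV. \<Sum>l\<in>UNIV. \<Sum>i\<in>I. s i * ((cnj (x $ k) * v i $ k) * (cnj (v i $ l) * x $ l)))"
      by (simp add: cinner_def matrix_vector_mult_def outer_def sum_distrib_left sum_distrib_right
          scaleR_conv_of_real[where 'a=complex] ac_simps)
    also have "\<dots> = (\<Sum>k\<in>UNIV. \<Sum>i\<in>I. \<Sum>l\<in>UNIV. s i * ((cnj (x $ k) * v i $ k) * (cnj (v i $ l) * x $ l)))"
      by (rule sum.cong[OF refl], rule sum.swap)
    also have "\<dots> = (\<Sum>i\<in>I. s i * (cinner x (v i) * cinner (v i) x))"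
      unfolding cinner_def
      unfolding sum_product
      unfolding sum_distrib_left by (rule sum.swap)
    also have "\<dots> = (\<Sum>i\<in>I. of_real (s i * (cmod (cinner (v i) x))\<^sup>2))"
    proof (rule sum.cong[OF refl])
      fix i
      have "cinner x (v i) = cnj (cinner (v i) x)"
        by (simp add: cinner_def mult.commute)
      then show "s i * (cinner x (v i) * cinner (v i) x) = of_real (s i * (cmod (cinner (v i) x))\<^sup>2)"
        using complex_norm_square[of "cinner (v i) x"] by (simp add: mult.commute)
    qed
    finally show ?thesis .
  qed
  then show ?thesis
    unfolding positive_semidefinite_def
    by (auto simp: adjoint_sum_outer intro!: sum_nonneg mult_nonneg_nonneg assms)
qed

lemma trace_sum_outer:
  "trace (\<Sum>i\<in>I. s i *\<^sub>R outer (v i) (v i)) = (\<Sum>i\<in>I. s i * cinner (v i) (v i))"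
  by (simp add: trace_def outer_def cinner_def sum_distrib_left scaleR_conv_of_real[where 'a=complex] mult.commute)
    (rule sum.swap)

text \<open>The sum is a singular value decomposition of a matrix \<open>M\<close>. The positive
  root of \<open>adjoint_mat M ** M\<close> is the same sum with \<open>u\<close> replaced by
  \<open>v\<close>, and its trace adds up the singular values.\<close>

lemma trace_norm_sum_outer:
  assumes "finite I" and "\<And>i. i \<in> I \<Longrightarrow> 0 \<le> s i"
    and u: "\<And>i j. i \<in> I \<Longrightarrow> j \<in> I \<Longrightarrow> cinner (u i) (u j) = (if i = j then 1 else 0)"
    and v: "\<And>i j. i \<in> I \<Longrightarrow> j \<in> I \<Longrightarrow> cinner (v i) (v j) = (if i = j then 1 else 0)"
  shows "trace_norm (\<Sum>i\<in>I. s i *\<^sub>R outer (u i) (v i)) = (\<Sum>i\<in>I. s i)"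
proof -
  define P where "P = (\<Sum>i\<in>I. s i *\<^sub>R outer (v i) (v i))"
  have "positive_semidefinite P"
    unfolding P_def by (rule psd_sum_outer) (rule assms)
  moreover have "P ** P = adjoint_mat (\<Sum>i\<in>I. s i *\<^sub>R outer (u i) (v i)) ** (\<Sum>i\<in>I. s i *\<^sub>R outer (u i) (v i))"
    unfolding P_def adjoint_sum_outer
    by (simp add: sum_outer_mult_sum_outer[where v=v and w=v, OF assms(1) v]
        sum_outer_mult_sum_outer[where v=u and w=u, OF assms(1) u])
  ultimately have "trace_norm (\<Sum>i\<in>I. s i *\<^sub>R outer (u i) (v i)) = Re (trace P)"
    unfolding trace_norm_def by (simp add: sqrt_mat_eqI)
  also have "\<dots> = (\<Sum>i\<in>I. s i)"
    unfolding P_def trace_sum_outer using v by simp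
  finally show ?thesis .
qed

section \<open>Negativity of a vector in Schmidt form\<close>

definition cnj_vec :: "complex ^ 'n::finite \<Rightarrow> complex ^ 'n" where
  "cnj_vec v = (\<chi> i. cnj (v $ i))"

lemma cinner_cnj_vec: "cinner (cnj_vec u) (cnj_vec v) = cnj (cinner u v)"
  by (simp add: cinner_def cnj_vec_def)

lemma cinner_tensor_vec: "cinner (tensor_vec u v) (tensor_vec x y) = cinner u x * cinner v y"
  unfolding cinner_def tensor_vec_def sum_product UNIV_Times_UNIV[symmetric]
  by (simp add: sum.cartesian_product case_prod_unfold ac_simps)

text \<open>Transposition sends \<open>|f j><f l|\<close> to \<open>|g l><g j|\<close>, where
  \<open>g\<close> is the entrywise conjugate of \<open>f\<close>. The partial transpose thus
  becomes a sum of rank-one operators indexed by pairs.\<close>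

lemma partial_transpose_schmidt:
  "partial_transpose (pure_state (\<Sum>j<n. s j *\<^sub>R tensor_vec (a j) (f j))) =
    (\<Sum>(j, l)\<in>{..<n} \<times> {..<n}. (s j * s l) *\<^sub>R
      outer (tensor_vec (a j) (cnj_vec (f l))) (tensor_vec (a l) (cnj_vec (f j))))"
  by (simp add: vec_eq_iff partial_transpose_def pure_state_def tensor_vec_def outer_def cnj_vec_def
      sum_product sum.cartesian_product case_prod_unfold scaleR_conv_of_real[where 'a=complex] ac_simps)

text \<open>Both product families in \<open>partial_transpose_schmidt\<close> are orthonormal, so
  the products \<open>s j * s l\<close> are the singular values, and their sum over all pairs is a
  square.\<close>

lemma trace_norm_partial_transpose_schmidt:
  assumes "orthonormal_family n a" and "orthonormal_family n f" and s: "\<And>j. j < n \<Longrightarrow> 0 \<le> s j"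
  shows "trace_norm (partial_transpose (pure_state (\<Sum>j<n. s j *\<^sub>R tensor_vec (a j) (f j)))) =
    (\<Sum>j<n. s j)\<^sup>2"
proof -
  have a: "cinner (a i) (a j) = (if i = j then 1 else 0)"
    and f: "cinner (f i) (f j) = (if i = j then 1 else 0)" if "i < n" "j < n" for i j
    using assms that by (simp_all add: orthonormal_family_def)
  have "trace_norm (partial_transpose (pure_state (\<Sum>j<n. s j *\<^sub>R tensor_vec (a j) (f j)))) =
     (\<Sum>x\<in>{..<n} \<times> {..<n}. s (fst x) * s (snd x))"
    unfolding partial_transpose_schmidt case_prod_unfold
    by (intro trace_norm_sum_outer) (auto simp: cinner_tensor_vec cinner_cnj_vec a f s split: if_splits)
  then show ?thesis
    by (simp add: power2_eq_square sum_product sum.cartesian_product case_prod_unfold)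
qed

lemma norm_schmidt:
  assumes "orthonormal_family n a" and "orthonormal_family n f"
  shows "(norm (\<Sum>j<n. s j *\<^sub>R tensor_vec (a j) (f j)))\<^sup>2 = (\<Sum>j<n. (s j)\<^sup>2)"
proof -
  have "tensor_vec (a i) (f i) \<bullet> tensor_vec (a j) (f j) = (if i = j then 1 else 0)"
    if "i < n" "j < n" for i j
    using assms that by (simp add: orthonormal_family_def cinner_tensor_vec flip: Re_cinner)
  then have "(\<Sum>i<n. s i * (tensor_vec (a i) (f i) \<bullet> tensor_vec (a j) (f j))) =
      (\<Sum>i<n. if i = j then s j else 0)" if "j < n" for j
    using that by (intro sum.cong refl) auto
  then show ?thesis
    by (simp add: power2_norm_eq_inner inner_sum_left inner_sum_right)
      (simp add: power2_eq_square)
qed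

lemma square_sum_lessThan:
  fixes s :: "nat \<Rightarrow> real"
  shows "(\<Sum>j<n. s j)\<^sup>2 =
    (\<Sum>j<n. (s j)\<^sup>2) + 2 * (\<Sum>(j, j') \<in> {(j, j'). j < j' \<and> j' < n}. s j * s j')"
proof (induction n)
  case (Suc n)
  have eq: "{(j, j'). j < j' \<and> j' < Suc n} = {(j, j'). j < j' \<and> j' < n} \<union> (\<lambda>j. (j, n)) ` {..<n}"
    by auto
  have "finite {(j, j'). j < j' \<and> j' < n}"
    by (rule finite_subset[of _ "{..<n} \<times> {..<n}"]) auto
  then have "(\<Sum>(j, j') \<in> {(j, j'). j < j' \<and> j' < Suc n}. s j * s j') =
      (\<Sum>(j, j') \<in> {(j, j'). j < j' \<and> j' < n}. s j * s j') + (\<Sum>j<n. s j) * s n"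
    unfolding eq
    by (subst sum.union_disjoint) (auto simp: sum.reindex inj_on_def sum_distrib_right)
  then show ?case
    using Suc by (simp add: power2_eq_square algebra_simps)
qed simp

text \<open>The squares sum to one and cancel the \<open>- 1\<close> in \<open>negativity\<close>,
  leaving twice the sum over pairs. Here \<open>s j\<close> is the square root of a Schmidt
  weight.\<close>

lemma negativity_schmidt:
  fixes a f :: "nat \<Rightarrow> complex ^ 'd::finite"
  assumes "orthonormal_basis a" and "orthonormal_basis f"
    and "\<And>j. j < CARD('d) \<Longrightarrow> 0 \<le> s j" and "(\<Sum>j<CARD('d). (s j)\<^sup>2) = 1"
  shows "negativity (pure_state (\<Sum>j<CARD('d). s j *\<^sub>R tensor_vec (a j) (f j))) =
    2 / (real CARD('d) - 1) * (\<Sum>(j, j') \<in> {(j, j'). j < j' \<and> j' < CARD('d)}. s j * s j')"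
  using assms
  by (simp add: negativity_def orthonormal_basis_def trace_norm_partial_transpose_schmidt square_sum_lessThan)

section \<open>Boundedness of the negativity and lower bounds from ensembles\<close>

lemma cmod_diagonal_le:
  fixes P M :: "complex ^ 'n::finite ^ 'n"
  assumes "adjoint_mat P = P" and "P ** P = adjoint_mat M ** M"
    and "\<And>i j. cmod (M $ i $ j) \<le> 1"
  shows "cmod (P $ i $ i) \<le> real CARD('n)"
proof -
  \<comment> \<open>A diagonal entry of \<open>adjoint_mat X ** X\<close> is the squared length of a
    column of \<open>X\<close>, so corresponding columns of \<open>P\<close> and \<open>M\<close>
    have equal length.\<close>
  have square: "(adjoint_mat X ** X) $ i $ i = of_real (\<Sum>k\<in>UNIV. (cmod (X $ k $ i))\<^sup>2)"
    for X :: "complex ^ 'n ^ 'n"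
    by (simp add: matrix_matrix_mult_def adjoint_mat_def complex_norm_square mult.commute
        del: of_real_power)
  have "(cmod (P $ i $ i))\<^sup>2 \<le> (\<Sum>k\<in>UNIV. (cmod (P $ k $ i))\<^sup>2)"
    by (rule member_le_sum) auto
  also have "\<dots> = (\<Sum>k\<in>UNIV. (cmod (M $ k $ i))\<^sup>2)"
    using square[of P] square[of M] assms(1,2) by (metis of_real_eq_iff)
  also have "\<dots> \<le> (\<Sum>k\<in>(UNIV :: 'n set). 1)"
    by (intro sum_mono) (simp add: assms(3) power_le_one)
  also have "\<dots> \<le> (real CARD('n))\<^sup>2"
    by (simp add: power2_eq_square)
  finally show ?thesis
    by (rule power2_le_imp_le) simp
qed

text \<open>
  If no positive square root existed, \<^const>\<open>sqrt_mat\<close> would take the one value that \<open>THE\<close> assigns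
  to the empty predicate, so the bound needs uniqueness of the root but not its existence.
\<close>

lemma trace_norm_bounded:
  obtains B where "\<And>M :: complex ^ 'n::finite ^ 'n. (\<And>i j. cmod (M $ i $ j) \<le> 1) \<Longrightarrow> trace_norm M \<le> B"
proof
  fix M :: "complex ^ 'n ^ 'n"
  assume M: "\<And>i j. cmod (M $ i $ j) \<le> 1"
  let ?N = "real CARD('n)"
  \<comment> \<open>The first argument of \<open>max\<close> is the crude bound from
    \<open>?N\<close> diagonal entries of modulus at most \<open>?N\<close>; the second is the real
    trace of the default value.\<close>
  let ?B = "max (?N * ?N) (Re (trace (THE P :: complex ^ 'n ^ 'n. False)))"
  show "trace_norm M \<le> ?B"
  proof (cases "\<exists>P. positive_semidefinite P \<and> P ** P = adjoint_mat M ** M")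
    case True
    then obtain P where P: "positive_semidefinite P" "P ** P = adjoint_mat M ** M" by blast
    then have "trace_norm M = Re (trace P)"
      by (simp add: trace_norm_def sqrt_mat_eqI)
    also have "\<dots> = (\<Sum>i\<in>UNIV. Re (P $ i $ i))"
      by (simp add: trace_def)
    also have "\<dots> \<le> (\<Sum>i\<in>(UNIV :: 'n set). ?N)"
      using P M by (intro sum_mono order_trans[OF complex_Re_le_cmod cmod_diagonal_le])
        (auto simp: positive_semidefinite_def)
    finally show ?thesis by simp
  next
    case False
    then have "(\<lambda>P. positive_semidefinite P \<and> P ** P = adjoint_mat M ** M) = (\<lambda>P. False)"
      by blast
    then show ?thesis by (simp add: trace_norm_def sqrt_mat_def)
  qed
qed

text \<open>Entries of a unit vector have modulus at most 1, hence so do those of the partially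
  transposed projector, and \<open>trace_norm_bounded\<close> applies uniformly.\<close>

lemma negativity_pure_state_bounded:
  obtains B where "\<And>\<psi> :: complex ^ ('d::finite \<times> 'd). norm \<psi> = 1 \<Longrightarrow> negativity (pure_state \<psi>) \<le> B"
proof -
  obtain B where B: "\<And>M :: complex ^ ('d \<times> 'd) ^ ('d \<times> 'd).
      (\<And>i j. cmod (M $ i $ j) \<le> 1) \<Longrightarrow> trace_norm M \<le> B"
    by (rule trace_norm_bounded) blast
  have "negativity (pure_state \<psi>) \<le> (B - 1) / (real CARD('d) - 1)"
    if "norm \<psi> = 1" for \<psi> :: "complex ^ ('d \<times> 'd)"
  proof -
    have "cmod (\<psi> $ i) \<le> 1" for i
      using Finite_Cartesian_Product.norm_nth_le[of \<psi> i] that by simp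
    then have "trace_norm (partial_transpose (pure_state \<psi>)) \<le> B"
      by (intro B) (simp add: partial_transpose_def pure_state_def norm_mult mult_le_one)
    then show ?thesis
      by (simp add: negativity_def divide_right_mono)
  qed
  then show ?thesis by (rule that)
qed

text \<open>A real \<open>Sup\<close> dominates its set only if the set is bounded above; the
  uniform bound on pure states supplies this, as ensemble values are averages. The general index set
  \<open>I\<close> admits ensembles indexed by pairs.\<close>

lemma negativity_of_assistance_ge:
  fixes \<psi> :: "'i \<Rightarrow> complex ^ ('d::finite \<times> 'd)"
  assumes "finite I" and "\<And>i. i \<in> I \<Longrightarrow> 0 \<le> w i" and "\<And>i. i \<in> I \<Longrightarrow> norm (\<psi> i) = 1"
    and "(\<Sum>i\<in>I. w i) = 1" and "\<rho> = (\<Sum>i\<in>I. w i *\<^sub>R pure_state (\<psi> i))"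
  shows "(\<Sum>i\<in>I. w i * negativity (pure_state (\<psi> i))) \<le> negativity_of_assistance \<rho>"
proof -
  obtain h where h: "bij_betw h {..<card I} I"
    using ex_bij_betw_nat_finite[OF assms(1)] by (auto simp: atLeast0LessThan)
  have "pure_decomposition \<rho> (card I) (w \<circ> h) (\<psi> \<circ> h)"
    unfolding pure_decomposition_def
    using assms(2-5) bij_betwE[OF h]
    by (auto simp: sum.reindex_bij_betw[OF h, of w]
        sum.reindex_bij_betw[OF h, of "\<lambda>i. w i *\<^sub>R pure_state (\<psi> i)"])
  moreover have "(\<Sum>i\<in>I. w i * negativity (pure_state (\<psi> i))) =
      (\<Sum>k<card I. (w \<circ> h) k * negativity (pure_state ((\<psi> \<circ> h) k)))"
    by (simp add: sum.reindex_bij_betw[OF h, of "\<lambda>i. w i * negativity (pure_state (\<psi> i))"])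
  ultimately have "(\<Sum>i\<in>I. w i * negativity (pure_state (\<psi> i))) \<in>
      {\<Sum>k<m. w k * negativity (pure_state (\<psi> k)) | m w \<psi>. pure_decomposition \<rho> m w \<psi>}"
    by blast
  moreover obtain B where B: "\<And>\<psi> :: complex ^ ('d \<times> 'd). norm \<psi> = 1 \<Longrightarrow> negativity (pure_state \<psi>) \<le> B"
    by (rule negativity_pure_state_bounded) blast
  have "bdd_above {\<Sum>k<m. w k * negativity (pure_state (\<psi> k)) | m w \<psi>. pure_decomposition \<rho> m w \<psi>}"
  proof (rule bdd_aboveI[of _ B], clarify)
    fix m w and \<psi> :: "nat \<Rightarrow> complex ^ ('d \<times> 'd)"
    assume dec: "pure_decomposition \<rho> m w \<psi>"
    then have "(\<Sum>k<m. w k * negativity (pure_state (\<psi> k))) \<le> (\<Sum>k<m. w k * B)"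
      by (intro sum_mono mult_left_mono B) (auto simp: pure_decomposition_def)
    then show "(\<Sum>k<m. w k * negativity (pure_state (\<psi> k))) \<le> B"
      using dec by (simp add: pure_decomposition_def flip: sum_distrib_right)
  qed
  ultimately show ?thesis
    unfolding negativity_of_assistance_def by (rule cSup_upper)
qed

section \<open>Roots of unity and cyclic shifts\<close>

lemma sum_root_of_unity_powers:
  fixes n :: nat and \<omega> :: "nat \<Rightarrow> complex"
  defines "\<omega> \<equiv> (\<lambda>j. cis (2 * pi * real j / real n))"
  assumes "j < n" and "l < n"
  shows "(\<Sum>m<n. \<omega> j ^ m * cnj (\<omega> l ^ m)) = (if j = l then of_nat n else 0)"
proof (cases "j = l")
  case True
  have "\<omega> l * cnj (\<omega> l) = 1"
    by (simp add: \<omega>_def cis_cnj cis_mult)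
  then have "\<omega> l ^ m * cnj (\<omega> l ^ m) = 1" for m
    by (metis complex_cnj_power power_mult_distrib power_one)
  then show ?thesis using True by simp
next
  case False
  have bij: "bij_betw \<omega> {..<n} {z. z ^ n = 1}"
    unfolding \<omega>_def by (rule Complex.bij_betw_roots_unity) (use assms in auto)
  \<comment> \<open>\<open>z\<close> is an \<open>n\<close>-th root of unity, and it differs from 1
    because \<omega> enumerates the roots injectively. The geometric sum
    \<open>(z ^ n - 1) / (z - 1)\<close> therefore vanishes.\<close>
  define z where "z = \<omega> j * cnj (\<omega> l)"
  have "\<omega> j ^ n = 1" "\<omega> l ^ n = 1"
    using bij_betwE[OF bij] assms by auto
  then have "z ^ n = 1"
    by (simp add: z_def power_mult_distrib flip: complex_cnj_power)
  moreover have "z \<noteq> 1"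
  proof
    assume "z = 1"
    moreover have "cnj (\<omega> l) * \<omega> l = 1"
      by (simp add: \<omega>_def cis_cnj cis_mult)
    ultimately have "\<omega> j = \<omega> l"
      unfolding z_def by (metis mult.assoc mult.left_neutral mult.right_neutral)
    then show False
      using bij assms False by (auto simp: bij_betw_def inj_on_def)
  qed
  ultimately have "(\<Sum>m<n. z ^ m) = 0"
    by (simp add: geometric_sum)
  then show ?thesis using False by (simp add: z_def power_mult_distrib)
qed

lemma bij_betw_add_mod:
  fixes d k :: nat
  shows "bij_betw (\<lambda>j. (j + k) mod d) {..<d} {..<d}"
proof -
  have "inj_on (\<lambda>j. (j + k) mod d) {..<d}"
  proof (rule inj_onI)
    fix i j assume ij: "i \<in> {..<d}" "j \<in> {..<d}" and eq: "(i + k) mod d = (j + k) mod d"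
    obtain u v where "i + k + d * u = j + k + d * v"
      using eq by (auto simp: nat_mod_eq_iff)
    then have "i mod d = j mod d"
      by (metis add.assoc add.commute add_left_cancel mod_mult_self2)
    then show "i = j" using ij by simp
  qed
  moreover have "(\<lambda>j. (j + k) mod d) ` {..<d} \<subseteq> {..<d}" by auto
  ultimately show ?thesis
    by (simp add: bij_betw_def endo_inj_surj)
qed

text \<open>Lets phases and the cyclic shift be absorbed into the second basis, so that the Schmidt
  coefficients stay real and nonnegative.\<close>

lemma orthonormal_basis_shift:
  fixes c :: "nat \<Rightarrow> complex ^ 'd::finite"
  assumes c: "orthonormal_basis c" and z: "\<And>j. cmod (z j) = 1"
  shows "orthonormal_basis (\<lambda>j. z j *s c ((j + k) mod CARD('d)))"
  unfolding orthonormal_basis_def orthonormal_family_def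
proof (intro allI impI)
  fix i j assume ij: "i < CARD('d)" "j < CARD('d)"
  have "cinner (z i *s c ((i + k) mod CARD('d))) (z j *s c ((j + k) mod CARD('d))) =
      cnj (z i) * z j * cinner (c ((i + k) mod CARD('d))) (c ((j + k) mod CARD('d)))"
    by (simp add: cinner_def sum_distrib_left ac_simps)
  also have "\<dots> = cnj (z i) * z j * (if (i + k) mod CARD('d) = (j + k) mod CARD('d) then 1 else 0)"
    using c by (simp add: orthonormal_basis_def orthonormal_family_def)
  also have "\<dots> = (if i = j then 1 else 0)"
    using inj_on_eq_iff[OF bij_betw_imp_inj_on[OF bij_betw_add_mod]] ij
      complex_norm_square[of "z j"] z[of j] by (simp add: mult.commute)
  finally show "cinner (z i *s c ((i + k) mod CARD('d))) (z j *s c ((j + k) mod CARD('d))) =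
      (if i = j then 1 else 0)" .
qed

section \<open>Reduced states and averaging over phases\<close>

lemma reduced_state_schmidt:
  fixes b :: "nat \<Rightarrow> complex ^ 'n::finite"
  assumes b: "orthonormal_family n b" and p: "\<And>j. j < n \<Longrightarrow> 0 \<le> p j"
    and \<phi>: "\<phi> = (\<Sum>j<n. sqrt (p j) *\<^sub>R tensor_vec (a j) (b j))"
  shows "(\<Sum>i\<in>UNIV. \<phi> $ (x, i) * cnj (\<phi> $ (y, i))) = (\<Sum>j<n. p j * (a j $ x * cnj (a j $ y)))"
proof -
  have "(\<Sum>i\<in>UNIV. \<phi> $ (x, i) * cnj (\<phi> $ (y, i))) =
      (\<Sum>i\<in>UNIV. \<Sum>j<n. \<Sum>l<n. sqrt (p j) * sqrt (p l) * (a j $ x * cnj (a l $ y)) * (cnj (b l $ i) * b j $ i))"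
    unfolding \<phi>
    by (simp add: tensor_vec_def sum_product scaleR_conv_of_real[where 'a=complex] ac_simps)
  \<comment> \<open>Tracing out the second factor collects the overlaps
    \<open>cinner (b l) (b j)\<close>, which remove the coherences between different Schmidt
    terms.\<close>
  also have "\<dots> = (\<Sum>j<n. \<Sum>l<n. sqrt (p j) * sqrt (p l) * (a j $ x * cnj (a l $ y)) * cinner (b l) (b j))"
    unfolding cinner_def sum_distrib_left
    by (subst sum.swap, rule sum.cong[OF refl], rule sum.swap)
  also have "\<dots> = (\<Sum>j<n. \<Sum>l<n. if l = j then p j * (a j $ x * cnj (a j $ y)) else 0)"
    using b p by (intro sum.cong refl) (auto simp: orthonormal_family_def simp flip: of_real_mult)
  finally show ?thesis by simp
qed

text \<open>For a product vector the trace over B and D factors into two separate reductions, each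
  diagonal in its Schmidt basis.\<close>

lemma trace_BD_schmidt:
  assumes "orthonormal_family n b" and "\<And>j. j < n \<Longrightarrow> 0 \<le> p j"
    and "orthonormal_family n e" and "\<And>j. j < n \<Longrightarrow> 0 \<le> q j"
    and "\<phi> = (\<Sum>j<n. sqrt (p j) *\<^sub>R tensor_vec (a j) (b j))"
    and "\<psi> = (\<Sum>j<n. sqrt (q j) *\<^sub>R tensor_vec (c j) (e j))"
  shows "trace_BD (pure_state (tensor_vec \<phi> \<psi>)) =
    (\<Sum>j<n. \<Sum>l<n. (p j * q l) *\<^sub>R pure_state (tensor_vec (a j) (c l)))"
proof -
  have "trace_BD (pure_state (tensor_vec \<phi> \<psi>)) $ x $ y =
      (\<Sum>j<n. \<Sum>l<n. (p j * q l) *\<^sub>R pure_state (tensor_vec (a j) (c l))) $ x $ y" for x y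
  proof -
    have "trace_BD (pure_state (tensor_vec \<phi> \<psi>)) $ x $ y =
      (\<Sum>i\<in>UNIV. \<phi> $ (fst x, i) * cnj (\<phi> $ (fst y, i))) *
      (\<Sum>i\<in>UNIV. \<psi> $ (snd x, i) * cnj (\<psi> $ (snd y, i)))"
      by (simp add: trace_BD_def pure_state_def tensor_vec_def sum_product ac_simps)
    also have "(\<Sum>i\<in>UNIV. \<phi> $ (fst x, i) * cnj (\<phi> $ (fst y, i))) = (\<Sum>j<n. p j * (a j $ fst x * cnj (a j $ fst y)))"
      using assms(1,2,5) by (rule reduced_state_schmidt)
    also have "(\<Sum>i\<in>UNIV. \<psi> $ (snd x, i) * cnj (\<psi> $ (snd y, i))) = (\<Sum>j<n. q j * (c j $ snd x * cnj (c j $ snd y)))"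
      using assms(3,4,6) by (rule reduced_state_schmidt)
    also have "(\<Sum>j<n. p j * (a j $ fst x * cnj (a j $ fst y))) * (\<Sum>j<n. q j * (c j $ snd x * cnj (c j $ snd y))) =
        (\<Sum>j<n. \<Sum>l<n. (p j * q l) *\<^sub>R pure_state (tensor_vec (a j) (c l))) $ x $ y"
      by (simp add: pure_state_def tensor_vec_def sum_product scaleR_conv_of_real[where 'a=complex] ac_simps)
    finally show ?thesis .
  qed
  then show ?thesis by (simp add: vec_eq_iff)
qed

text \<open>The coherence between \<open>j\<close> and \<open>l\<close> carries the factor
  \<open>\<omega> j ^ m * cnj (\<omega> l ^ m)\<close>. Summing over \<open>m\<close> kills it for
  \<open>j \<noteq> l\<close> and counts each diagonal term \<open>n\<close> times.\<close>

lemma sum_pure_state_phases: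
  fixes n :: nat and \<omega> :: "nat \<Rightarrow> complex"
  defines "\<omega> \<equiv> (\<lambda>j. cis (2 * pi * real j / real n))"
  shows "(\<Sum>m<n. pure_state (\<Sum>j<n. s j *\<^sub>R tensor_vec (a j) (\<omega> j ^ m *s f j))) =
    real n *\<^sub>R (\<Sum>j<n. (s j)\<^sup>2 *\<^sub>R pure_state (tensor_vec (a j) (f j)))"
proof -
  have "(\<Sum>m<n. pure_state (\<Sum>j<n. s j *\<^sub>R tensor_vec (a j) (\<omega> j ^ m *s f j))) $ x $ y =
    (real n *\<^sub>R (\<Sum>j<n. (s j)\<^sup>2 *\<^sub>R pure_state (tensor_vec (a j) (f j)))) $ x $ y" for x y
  proof -
    let ?t = "\<lambda>j. tensor_vec (a j) (f j)"
    have "(\<Sum>m<n. pure_state (\<Sum>j<n. s j *\<^sub>R tensor_vec (a j) (\<omega> j ^ m *s f j))) $ x $ y =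
      (\<Sum>m<n. \<Sum>j<n. \<Sum>l<n. s j * s l * (?t j $ x * cnj (?t l $ y)) * (\<omega> j ^ m * cnj (\<omega> l ^ m)))"
      by (simp add: pure_state_def tensor_vec_def sum_product scaleR_conv_of_real[where 'a=complex] ac_simps)
    also have "\<dots> = (\<Sum>j<n. \<Sum>l<n. s j * s l * (?t j $ x * cnj (?t l $ y)) * (\<Sum>m<n. \<omega> j ^ m * cnj (\<omega> l ^ m)))"
      unfolding sum_distrib_left
      by (subst sum.swap, rule sum.cong[OF refl], rule sum.swap)
    also have "\<dots> = (\<Sum>j<n. \<Sum>l<n. if l = j then s j * s j * (?t j $ x * cnj (?t j $ y)) * of_nat n else 0)"
      unfolding \<omega>_def by (intro sum.cong refl) (auto simp: sum_root_of_unity_powers simp del: complex_cnj_power)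
    finally show ?thesis
      by (simp add: pure_state_def scaleR_conv_of_real[where 'a=complex] power2_eq_square sum_distrib_left ac_simps)
  qed
  then show ?thesis by (simp add: vec_eq_iff)
qed

theorem mainTheorem3:
  fixes d :: nat
    and \<phi> \<psi> :: "complex ^ ('d::finite \<times> 'd)"
    and \<Phi> :: "complex ^ (('d \<times> 'd) \<times> ('d \<times> 'd))"
    and \<rho>\<^sub>A\<^sub>C :: "complex ^ ('d \<times> 'd) ^ ('d \<times> 'd)"
    and a b c e :: "nat \<Rightarrow> complex ^ 'd"
    and p q :: "nat \<Rightarrow> real"
  assumes "d = CARD('d)" and "2 \<le> d"
    and "norm \<phi> = 1" and "norm \<psi> = 1"
    and "orthonormal_basis a" and "orthonormal_basis b"
    and "orthonormal_basis c" and "orthonormal_basis e"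
    and "\<And>j. j < d \<Longrightarrow> 0 \<le> p j" and "(\<Sum>j<d. p j) = 1"
    and "\<And>j. j < d \<Longrightarrow> 0 \<le> q j" and "(\<Sum>j<d. q j) = 1"
    and "\<phi> = (\<Sum>j<d. sqrt (p j) *\<^sub>R tensor_vec (a j) (b j))"
    and "\<psi> = (\<Sum>j<d. sqrt (q j) *\<^sub>R tensor_vec (c j) (e j))"
    and "\<Phi> = tensor_vec \<phi> \<psi>"
    and "\<rho>\<^sub>A\<^sub>C = trace_BD (pure_state \<Phi>)"
  shows "negativity_of_assistance \<rho>\<^sub>A\<^sub>C \<ge>
    2 / (real d - 1) *
      (\<Sum>k<d. \<Sum>(j, j') \<in> {(j, j'). j < j' \<and> j' < d}.
         sqrt (p j * p j') * sqrt (q ((j + k) mod d) * q ((j' + k) mod d)))"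
proof -
  \<comment> \<open>\<open>r k\<close> is the total weight of the eigenvectors with shift
    \<open>k\<close>. It is moved into the ensemble weights because
    \<open>pure_decomposition\<close> requires unit vectors.\<close>
  define r where "r k = (\<Sum>j<d. p j * q ((j + k) mod d))" for k
  \<comment> \<open>When \<open>r k = 0\<close> the ensemble weight vanishes and any unit coefficient vector serves.\<close>
  define s where "s k j = (if r k = 0 then sqrt (p j) else sqrt (p j * q ((j + k) mod d) / r k))" for k j
  define \<omega> where "\<omega> j = cis (2 * pi * real j / real d)" for j
  define \<eta> where "\<eta> k m = (\<Sum>j<d. s k j *\<^sub>R tensor_vec (a j) (\<omega> j ^ m *s c ((j + k) mod d)))" for k m
  have d: "d > 0" using assms(2) by simp
  have p: "0 \<le> p j" and q: "0 \<le> q ((j + k) mod d)" if "j < d" for j k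
    using assms(9,11) that d by auto
  have r: "0 \<le> r k" for k
    unfolding r_def by (intro sum_nonneg mult_nonneg_nonneg p q) auto
  have s: "0 \<le> s k j" if "j < d" for k j
    using p q r that by (simp add: s_def)
  have r_0: "p j * q ((j + k) mod d) = 0" if "r k = 0" "j < d" for k j
    using that p q unfolding r_def by (subst (asm) sum_nonneg_eq_0_iff) auto
  \<comment> \<open>The weight \<open>r k\<close> undoes the normalisation in \<open>s\<close>. If
    \<open>r k = 0\<close>, all products \<open>p j * q ((j + k) mod d)\<close> vanish, so both
    sides are zero.\<close>
  have r_s: "r k * (s k j * s k l) = sqrt (p j * p l) * sqrt (q ((j + k) mod d) * q ((l + k) mod d))"
    if "j < d" "l < d" for k j l
  proof (cases "r k = 0")
    case True
    then show ?thesis using r_0[of k j] r_0[of k l] that by (auto simp: real_sqrt_mult)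
  next
    case False
    then show ?thesis using r[of k] by (simp add: s_def real_sqrt_mult real_sqrt_divide)
  qed
  have r_s2: "r k * (s k j)\<^sup>2 = p j * q ((j + k) mod d)" if "j < d" for k j
    using r_s[OF that that, of k] p[OF that] q[OF that, of k] by (simp add: power2_eq_square)
  have s_sum: "(\<Sum>j<d. (s k j)\<^sup>2) = 1" for k
  proof (cases "r k = 0")
    case True
    then show ?thesis using p assms(10) by (simp add: s_def)
  next
    case False
    have "r k * (\<Sum>j<d. (s k j)\<^sup>2) = r k"
      by (simp add: sum_distrib_left r_s2) (simp add: r_def)
    then show ?thesis using False by simp
  qed
  have basis: "orthonormal_basis (\<lambda>j. \<omega> j ^ m *s c ((j + k) mod d))" for k m
    unfolding assms(1) by (rule orthonormal_basis_shift) (simp_all add: assms(7) \<omega>_def norm_power)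
  have norm: "norm (\<eta> k m) = 1" for k m
    using norm_schmidt[of d a "\<lambda>j. \<omega> j ^ m *s c ((j + k) mod d)" "s k"] basis[of m k] assms(1,5) s_sum
    by (simp add: \<eta>_def orthonormal_basis_def power2_eq_1_iff) (smt (verit) norm_ge_zero)
  have neg: "negativity (pure_state (\<eta> k m)) =
      2 / (real d - 1) * (\<Sum>(j, j') \<in> {(j, j'). j < j' \<and> j' < d}. s k j * s k j')" for k m
    using negativity_schmidt[OF assms(5) basis[of m k], of "s k"] s s_sum[of k]
    by (simp add: \<eta>_def flip: assms(1))
  \<comment> \<open>For fixed \<open>j\<close> the shifts \<open>k\<close> run through all second
    indices, which converts sums over shifts into sums over all eigenvectors.\<close>
  have reindex: "(\<Sum>k<d. g ((j + k) mod d)) = (\<Sum>l<d. g l)" for j and g :: "nat \<Rightarrow> 'x::comm_monoid_add"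
    using sum.reindex_bij_betw[OF bij_betw_add_mod[of j d], of g] by (simp add: add.commute)
  \<comment> \<open>Each \<eta> vector has weight \<open>r k / d\<close>. Summing over the phases
    yields a factor \<open>d\<close> that cancels the denominator, and the pairs
    \<open>(j, j + k)\<close> exhaust all pairs \<open>(j, l)\<close>.\<close>
  have "(\<Sum>(k, m)\<in>{..<d} \<times> {..<d}. (r k / d) *\<^sub>R pure_state (\<eta> k m)) =
      (\<Sum>k<d. (r k / d) *\<^sub>R (\<Sum>m<d. pure_state (\<eta> k m)))"
    by (simp add: scaleR_sum_right flip: sum.cartesian_product)
  also have "\<dots> = (\<Sum>k<d. \<Sum>j<d. (r k * (s k j)\<^sup>2) *\<^sub>R pure_state (tensor_vec (a j) (c ((j + k) mod d))))"
    unfolding \<eta>_def \<omega>_def sum_pure_state_phases using d by (simp add: scaleR_sum_right)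
  also have "\<dots> = (\<Sum>j<d. \<Sum>k<d. (p j * q ((j + k) mod d)) *\<^sub>R pure_state (tensor_vec (a j) (c ((j + k) mod d))))"
    by (subst sum.swap) (simp add: r_s2)
  also have "\<dots> = (\<Sum>j<d. \<Sum>l<d. (p j * q l) *\<^sub>R pure_state (tensor_vec (a j) (c l)))"
    by (intro sum.cong refl reindex)
  also have "\<dots> = \<rho>\<^sub>A\<^sub>C"
    unfolding assms(15,16)
    using assms(1,6,8,9,11,13,14)
    by (intro trace_BD_schmidt[symmetric]) (auto simp: orthonormal_basis_def)
  finally have \<rho>: "\<rho>\<^sub>A\<^sub>C = (\<Sum>(k, m)\<in>{..<d} \<times> {..<d}. (r k / d) *\<^sub>R pure_state (\<eta> k m))" ..
  have "(\<Sum>k<d. r k) = (\<Sum>j<d. \<Sum>k<d. p j * q ((j + k) mod d))"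
    unfolding r_def by (rule sum.swap)
  also have "\<dots> = (\<Sum>j<d. p j * (\<Sum>l<d. q l))"
    by (simp add: reindex flip: sum_distrib_left)
  finally have r_sum: "(\<Sum>k<d. r k) = 1"
    using assms(10,12) by simp
  have "(\<Sum>(k, m)\<in>{..<d} \<times> {..<d}. r k / d * negativity (pure_state (\<eta> k m))) =
      (\<Sum>k<d. \<Sum>m<d. r k / d * negativity (pure_state (\<eta> k m)))"
    by (simp add: sum.cartesian_product)
  \<comment> \<open>By \<open>neg\<close> the negativity is independent of \<open>m\<close>, so the
    \<open>d\<close> equal terms cancel the denominator \<open>d\<close>.\<close>
  also have "\<dots> = (\<Sum>k<d. 2 / (real d - 1) * (\<Sum>(j, j') \<in> {(j, j'). j < j' \<and> j' < d}. r k * (s k j * s k j')))"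
    unfolding neg using d by (simp add: sum_distrib_left case_prod_unfold ac_simps)
  also have "\<dots> = 2 / (real d - 1) *
      (\<Sum>k<d. \<Sum>(j, j') \<in> {(j, j'). j < j' \<and> j' < d}.
         sqrt (p j * p j') * sqrt (q ((j + k) mod d) * q ((j' + k) mod d)))"
    unfolding sum_distrib_left[symmetric]
    by (intro arg_cong2[where f="(*)"] sum.cong refl) (auto intro: r_s)
  finally have "2 / (real d - 1) *
      (\<Sum>k<d. \<Sum>(j, j') \<in> {(j, j'). j < j' \<and> j' < d}.
         sqrt (p j * p j') * sqrt (q ((j + k) mod d) * q ((j' + k) mod d))) =
      (\<Sum>x\<in>{..<d} \<times> {..<d}. r (fst x) / d * negativity (pure_state (\<eta> (fst x) (snd x))))"
    by (simp add: case_prod_unfold)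
  also have "\<dots> \<le> negativity_of_assistance \<rho>\<^sub>A\<^sub>C"
  proof (rule negativity_of_assistance_ge)
    have "(\<Sum>x\<in>{..<d} \<times> {..<d}. r (fst x) / d) = (\<Sum>k<d. \<Sum>m<d. r k / d)"
      unfolding sum.cartesian_product case_prod_unfold ..
    then show "(\<Sum>x\<in>{..<d} \<times> {..<d}. r (fst x) / d) = 1"
      using r_sum d by simp
  qed (use r norm \<rho> in \<open>auto simp: case_prod_unfold\<close>)
  finally show ?thesis .
qed

end
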